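(* Let $K$ be a convex pentagon and let $K_1$ be the pentagon formed by the diagonals of $K$. Then $$\frac{\Delta(K_1)}{\Delta(K)}\le \frac{7-3\sqrt{5}}{2},$$ with equality if and only if $K$ is an affine regular pentagon (the image of a regular pentagon under an invertible affine map).
   Context: For a convex pentagon $K=A_1A_2A_3A_4A_5$ (indices modulo $5$), $K_1=B_1\ldots B_5$ is the pentagon bounded by the five diagonals, where $B_i$ is the intersection of $A_{i-1}A_{i+1}$ and $A_iA_{i+2}$. $\Delta(\cdot)$ denotes area. *)

theory Defs
  imports "HOL-Analysis.Analysis"
begin

text \<open>Points of the plane are vectors in real^2. A pentagon is given by its
vertex function A on indices 0..4; indices are taken modulo 5.\<close>

definition cross2 :: "real^2 \<Rightarrow> real^2 \<Rightarrow> real" where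
  "cross2 u v = u$1 * v$2 - u$2 * v$1"

definition orient :: "real^2 \<Rightarrow> real^2 \<Rightarrow> real^2 \<Rightarrow> real" where
  "orient P Q R = cross2 (Q - P) (R - P)"

text \<open>Strictly convex pentagon with vertices listed in cyclic order (either
orientation): for each side A_i A_(i+1), all other vertices lie strictly on the
same side of the line through it.\<close>
definition convex_pentagon :: "(nat \<Rightarrow> real^2) \<Rightarrow> bool" where
  "convex_pentagon A \<longleftrightarrow>
     (\<forall>i<5. \<forall>j<5. j \<noteq> i \<and> j \<noteq> (i+1) mod 5 \<longrightarrow> orient (A i) (A ((i+1) mod 5)) (A j) > 0) \<or>
     (\<forall>i<5. \<forall>j<5. j \<noteq> i \<and> j \<noteq> (i+1) mod 5 \<longrightarrow> orient (A i) (A ((i+1) mod 5)) (A j) < 0)"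

definition line_inter :: "real^2 \<Rightarrow> real^2 \<Rightarrow> real^2 \<Rightarrow> real^2 \<Rightarrow> real^2" where
  "line_inter P Q R S = (THE X. X \<in> affine hull {P, Q} \<and> X \<in> affine hull {R, S})"

definition inner_pentagon :: "(nat \<Rightarrow> real^2) \<Rightarrow> nat \<Rightarrow> real^2" where
  "inner_pentagon A i =
     line_inter (A ((i+4) mod 5)) (A ((i+1) mod 5)) (A (i mod 5)) (A ((i+2) mod 5))"

definition pent_area :: "(nat \<Rightarrow> real^2) \<Rightarrow> real" where
  "pent_area P = measure lebesgue (convex hull (P ` {..<5}))"

definition regular_pentagon :: "(nat \<Rightarrow> real^2) \<Rightarrow> bool" where
  "regular_pentagon P \<longleftrightarrow> (\<exists>c r \<theta> s. r > 0 \<and> (s = 1 \<or> s = -1) \<and>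
     (\<forall>k<5. P k = c + (\<chi> j. if j = 1 then r * cos (\<theta> + s * 2 * pi * real k / 5)
                                   else r * sin (\<theta> + s * 2 * pi * real k / 5))))"

definition affine_regular_pentagon :: "(nat \<Rightarrow> real^2) \<Rightarrow> bool" where
  "affine_regular_pentagon A \<longleftrightarrow> (\<exists>P (M::real^2^2) t. regular_pentagon P \<and> invertible M \<and>
     (\<forall>k<5. A k = M *v P k + t))"

end

(*
Put the origin at one vertex and unit vectors along the two diagonals through it. With the parameters
m, n, y, z of pentagon_normal_form the two areas are, up to a common factor,
  1 + y + z   and   m n (2 - m - n) / (1 - m n) - D^2 / (F G),
where D = m n (1 + y) (1 + z) - y z and F, G are linear in y, z.  By AM-GM the last term is at least h^2 with
h = 2 D / (F + G), and h^2 >= 2 mu h - mu^2 for a suitable mu depending on m + n only.  What is left becomes,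
after clearing F + G, a quadratic in y - z.  Its part that is symmetric in the two diagonals is
(a - g)^2 times a positive factor, with a = (m + n) / 2 and g = (sqrt 5 - 1) / 2; the asymmetric part is
dominated by the loss in m n (2 - m - n) / (1 - m n) when m and n differ.  Equality therefore forces
m = n = y = z = g, which are the parameters of the regular pentagon.
*)
theory Submission
  imports Defs
begin

section \<open>The golden ratio\<close>

definition golden :: real where "golden = (sqrt 5 - 1) / 2"

lemma golden_sq: "golden\<^sup>2 = 1 - golden"
  by (simp add: golden_def power2_eq_square field_simps)

lemma golden_bounds: "618/1000 < golden" "golden < 6181/10000"
proof -
  have "2236/1000 < sqrt 5" by (rule real_less_rsqrt) (simp add: power2_eq_square)
  moreover have "sqrt 5 < 22362/10000" by (rule real_less_lsqrt) (simp_all add: power2_eq_square)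
  ultimately show "618/1000 < golden" "golden < 6181/10000" by (simp_all add: golden_def)
qed

text \<open>Both sides are \<^term>\<open>golden ^ 4\<close>.\<close>

lemma golden_fourth: "(7 - 3 * sqrt 5) / 2 = 2 - 3 * golden"
  by (simp add: golden_def field_simps)

section \<open>The area inequality\<close>

text \<open>Positivity of \<^term>\<open>chord_gap a k r\<close> makes the coefficient \<open>W\<close> of \<^term>\<open>b\<^sup>2\<close> in \<open>midpoint_ratio_bound\<close>
  positive. The decimal \<^term>\<open>47/200\<close> bounds \<^term>\<open>2 * golden - 1\<close> from below, and
  \<^term>\<open>423/50 * a - 13/5\<close> bounds from above the values of \<^term>\<open>r\<close> that matter (\<open>radius_le_chord\<close>).\<close>

definition chord_gap :: "real \<Rightarrow> real \<Rightarrow> real \<Rightarrow> real" where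
  "chord_gap a k r = 2 * (2 * a + (1 + a) * r) - (1 + a) * (a - 47/200) * (k * (2 + r)\<^sup>2 + a\<^sup>2)"

text \<open>The polynomials are expanded in the Bernstein basis of the given interval of \<^term>\<open>a\<close>, where
  all coefficients turn out to be nonnegative.\<close>

lemma chord_gap_left_low:
  fixes a :: real
  assumes "3/10 \<le> a" "a \<le> 1/2"
  shows "1/10 \<le> chord_gap a 1 0"
proof -
  define u v where "u = (a - 3/10) / (1/5)" and "v = 1 - u"
  have a: "a = 3/10 + (1/5) * u" by (simp add: u_def field_simps)
  have uv: "u \<ge> 0" "v \<ge> 0" using assms by (auto simp: u_def v_def)
  have "chord_gap a 1 0 - 1/10 = 150879/200000 * (v^4) + 269087/100000 * (u * v^3) + 6693/2000 *
      (u^2 * v^2) + 6489/4000 * (u^3 * v) + 337/1600 * (u^4)"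
    unfolding chord_gap_def a v_def by (simp add: field_simps power_numeral_reduce)
  also have "\<dots> \<ge> 0" using uv by (intro add_nonneg_nonneg mult_nonneg_nonneg) auto
  finally show ?thesis by simp
qed

lemma chord_gap_right_low:
  fixes a :: real
  assumes "3/10 \<le> a" "a \<le> 1/2"
  shows "1/10 \<le> chord_gap a 1 (423/50 * a - 13/5)"
proof -
  define u v where "u = (a - 3/10) / (1/5)" and "v = 1 - u"
  have a: "a = 3/10 + (1/5) * u" by (simp add: u_def field_simps)
  have uv: "u \<ge> 0" "v \<ge> 0" using assms by (auto simp: u_def v_def)
  have "chord_gap a 1 (423/50 * a - 13/5) - 1/10 = 306913091/500000000 * (v^4) +
      1503870523/250000000 * (u * v^3) + 12818017/1000000 * (u^2 * v^2) + 89852829/10000000 *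
      (u^3 * v) + 5811229/4000000 * (u^4)"
    unfolding chord_gap_def a v_def by (simp add: field_simps power_numeral_reduce)
  also have "\<dots> \<ge> 0" using uv by (intro add_nonneg_nonneg mult_nonneg_nonneg) auto
  finally show ?thesis by simp
qed

lemma chord_gap_left_mid:
  fixes a :: real
  assumes "1/2 \<le> a" "a \<le> 7/10"
  shows "1/10 \<le> chord_gap a (2 - 2 * a) 0"
proof -
  define u v where "u = (a - 1/2) / (1/5)" and "v = 1 - u"
  have a: "a = 1/2 + (1/5) * u" by (simp add: u_def field_simps)
  have uv: "u \<ge> 0" "v \<ge> 0" using assms by (auto simp: u_def v_def)
  have "chord_gap a (2 - 2 * a) 0 - 1/10 = 337/1600 * (v^4) + 559/800 * (u * v^3) + 713/625 * (u^2 *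
      v^2) + 106973/100000 * (u^3 * v) + 83091/200000 * (u^4)"
    unfolding chord_gap_def a v_def by (simp add: field_simps power_numeral_reduce)
  also have "\<dots> \<ge> 0" using uv by (intro add_nonneg_nonneg mult_nonneg_nonneg) auto
  finally show ?thesis by simp
qed

lemma chord_gap_right_mid:
  fixes a :: real
  assumes "1/2 \<le> a" "a \<le> 7/10"
  shows "1/10 \<le> chord_gap a (2 - 2 * a) (423/50 * a - 13/5)"
proof -
  define u v where "u = (a - 1/2) / (1/5)" and "v = 1 - u"
  have a: "a = 1/2 + (1/5) * u" by (simp add: u_def field_simps)
  have uv: "u \<ge> 0" "v \<ge> 0" using assms by (auto simp: u_def v_def)
  have "chord_gap a (2 - 2 * a) (423/50 * a - 13/5) - 1/10 = 5811229/4000000 * (v^5) +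
      123702189/20000000 * (u * v^4) + 430254933/50000000 * (u^2 * v^3) + 1027289817/250000000 *
      (u^3 * v^2) + 910221657/2500000000 * (u^4 * v) + 433829197/2500000000 * (u^5)"
    unfolding chord_gap_def a v_def by (simp add: field_simps power_numeral_reduce)
  also have "\<dots> \<ge> 0" using uv by (intro add_nonneg_nonneg mult_nonneg_nonneg) auto
  finally show ?thesis by simp
qed

lemma chord_gap_left_high:
  fixes a :: real
  assumes "7/10 \<le> a" "a \<le> 1"
  shows "1/10 \<le> chord_gap a (2 - 2 * a) 0"
proof -
  define u v where "u = (a - 7/10) / (3/10)" and "v = 1 - u"
  have a: "a = 7/10 + (3/10) * u" by (simp add: u_def field_simps)
  have uv: "u \<ge> 0" "v \<ge> 0" using assms by (auto simp: u_def v_def)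
  have "chord_gap a (2 - 2 * a) 0 - 1/10 = 83091/200000 * (v^4) + 509991/200000 * (u * v^3) +
      61119/10000 * (u^2 * v^2) + 12711/2000 * (u^3 * v) + 237/100 * (u^4)"
    unfolding chord_gap_def a v_def by (simp add: field_simps power_numeral_reduce)
  also have "\<dots> \<ge> 0" using uv by (intro add_nonneg_nonneg mult_nonneg_nonneg) auto
  finally show ?thesis by simp
qed

lemma chord_gap_right_high:
  fixes a :: real
  assumes "7/10 \<le> a" "a \<le> 1"
  shows "1/10 \<le> chord_gap a (2 - 2 * a) (423/50 * a - 13/5)"
proof -
  define u v where "u = (a - 7/10) / (3/10)" and "v = 1 - u"
  have a: "a = 7/10 + (3/10) * u" by (simp add: u_def field_simps)
  have uv: "u \<ge> 0" "v \<ge> 0" using assms by (auto simp: u_def v_def)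
  have "chord_gap a (2 - 2 * a) (423/50 * a - 13/5) - 1/10 = 433829197/2500000000 * (v^5) +
      4057532477/2500000000 * (u * v^4) + 914375521/62500000 * (u^2 * v^3) + 234670961/5000000 *
      (u^3 * v^2) + 9252473/156250 * (u^4 * v) + 2581/100 * (u^5)"
    unfolding chord_gap_def a v_def by (simp add: field_simps power_numeral_reduce)
  also have "\<dots> \<ge> 0" using uv by (intro add_nonneg_nonneg mult_nonneg_nonneg) auto
  finally show ?thesis by simp
qed

text \<open>\<open>chord_gap a k r\<close> is quadratic in \<open>r\<close> with leading coefficient
  \<open>- (1 + a) * (a - 47/200) * k\<close>. The last summand is \<open>R\<close> times its rise
  above the chord from \<open>0\<close> to \<open>R\<close>.\<close>

lemma chord_gap_concave:
  fixes a k r R :: real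
  shows "R * chord_gap a k r = (R - r) * chord_gap a k 0 + r * chord_gap a k R
           + (1 + a) * (a - 47/200) * k * R * r * (R - r)"
  by (simp add: chord_gap_def field_simps power2_eq_square)

text \<open>Concavity in \<open>r\<close> leaves only the two ends of the range of \<open>r\<close>,
  and monotonicity in \<open>k\<close> only the largest admissible \<open>k\<close>. This makes both
  end values polynomials in \<open>a\<close> alone.\<close>

lemma chord_gap_pos:
  fixes a k r :: real
  assumes a: "309/1000 \<le> a" "a \<le> 1" and k: "k \<le> 1" "k \<le> 2 - 2 * a"
    and r: "0 \<le> r" "r \<le> 423/50 * a - 13/5"
  shows "0 < chord_gap a k r"
proof -
  define R where "R = 423/50 * a - 13/5"
  have R: "R > 0" using a by (simp add: R_def)
  \<comment> \<open>The smaller of the two upper bounds on \<open>k\<close>.\<close>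
  define K where "K = (if a \<le> 1/2 then 1 else 2 - 2 * a)"
  have K: "0 \<le> K" "k \<le> K" using a k by (auto simp: K_def)
  have z: "1/10 \<le> chord_gap a K 0"
    using a chord_gap_left_low chord_gap_left_mid chord_gap_left_high
    by (cases "a \<le> 1/2"; cases "a \<le> 7/10") (auto simp: K_def)
  have c: "1/10 \<le> chord_gap a K R"
    using a chord_gap_right_low chord_gap_right_mid chord_gap_right_high
    by (cases "a \<le> 1/2"; cases "a \<le> 7/10") (auto simp: K_def R_def)
  have "0 < R * (1/10)" using R by simp
  also have "\<dots> = (R - r) * (1/10) + r * (1/10)" by (simp add: field_simps)
  also have "\<dots> \<le> (R - r) * chord_gap a K 0 + r * chord_gap a K R"
    using z c r by (intro add_mono mult_left_mono) (auto simp: R_def)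
  also have "\<dots> \<le> R * chord_gap a K r"
    unfolding chord_gap_concave[of R a K r]
    using a r K R by (auto simp: R_def)
  finally have "0 < chord_gap a K r" using R by (simp add: zero_less_mult_iff)
  moreover have "chord_gap a k r - chord_gap a K r = (1 + a) * (a - 47/200) * ((K - k) * (2 + r)\<^sup>2)"
    unfolding chord_gap_def by algebra
  moreover have "\<dots> \<ge> 0" using a K by (intro mult_nonneg_nonneg) auto
  ultimately show ?thesis by linarith
qed

text \<open>\<open>P / (1 - P)\<close> grows with \<open>P\<close>, so \<open>P\<close> may be
  raised to \<open>a\<^sup>2\<close>. Then \<open>1 + r\<close> lies below a multiple of
  \<open>a\<^sup>2 / (1 + a)\<close>, which is convex in \<open>a\<close>, and a chord of it yields
  the linear bound on \<open>r\<close>.\<close>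

lemma radius_le_chord:
  fixes a P r :: real
  assumes a: "0 < a" "a < 1" and P: "0 < P" "P \<le> a\<^sup>2" and r: "0 \<le> r"
    and M: "(2 - 3 * golden) * (1 + r) < 2 * P * (1 - a) / (1 - P)"
  shows "309/1000 < a" "r \<le> 423/50 * a - 13/5"
proof -
  have a2: "a\<^sup>2 < 1" using a by (simp add: power_less_one_iff)
  have "2 * P * (1 - a) / (1 - P) \<le> 2 * a\<^sup>2 * (1 - a) / (1 - a\<^sup>2)"
    using a P a2 by (intro frac_le mult_right_mono) auto
  also have "\<dots> = 2 * a\<^sup>2 / (1 + a)"
    using a a2 by (simp add: divide_simps) algebra
  finally have "(2 - 3 * golden) * (1 + r) < 2 * a\<^sup>2 / (1 + a)" using M by linarith
  then have 1: "(2 - 3 * golden) * (1 + r) * (1 + a) < 2 * a\<^sup>2" using a by (simp add: field_simps)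
  \<comment> \<open>\<open>5 + 3 * golden\<close> is the inverse of
    \<open>2 - 3 * golden\<close>.\<close>
  have "(5 + 3 * golden) * ((2 - 3 * golden) * (1 + r) * (1 + a)) < (5 + 3 * golden) * (2 * a\<^sup>2)"
    using 1 golden_bounds by (intro mult_strict_left_mono) auto
  moreover have "(5 + 3 * golden) * ((2 - 3 * golden) * (1 + r) * (1 + a)) = (1 + r) * (1 + a)"
    using golden_sq by algebra
  ultimately have 2: "(1 + r) * (1 + a) < (5 + 3 * golden) * (2 * a\<^sup>2)" by simp
  have "1 + a \<le> (1 + r) * (1 + a)" using a r by simp
  moreover have "(5 + 3 * golden) * (2 * a\<^sup>2) - (1 + a) = (2 * a - golden) * ((5 + 3 * golden) * a + (1 + golden))"
    using golden_sq by algebra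
  ultimately have "0 < (2 * a - golden) * ((5 + 3 * golden) * a + (1 + golden))" using 2 by linarith
  moreover have "0 < (5 + 3 * golden) * a + (1 + golden)"
    using a golden_bounds by (intro add_pos_pos mult_pos_pos) auto
  ultimately have a3: "golden < 2 * a" by (simp add: zero_less_mult_iff)
  then show "309/1000 < a" using golden_bounds by simp
  \<comment> \<open>\<open>(6 + 4 * golden) * a - (1 + golden)\<close> is the chord of
    \<open>2 * (5 + 3 * golden) * a\<^sup>2 / (1 + a)\<close> between \<open>a = golden / 2\<close>,
    where both equal 1, and \<open>a = 1\<close>.\<close>
  have "((6 + 4 * golden) * a - (1 + golden)) * (1 + a) - (5 + 3 * golden) * (2 * a\<^sup>2)
          = (2 + golden) * (1 - a) * (2 * a - golden)"
    using golden_sq by algebra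
  moreover have "\<dots> \<ge> 0" using a a3 golden_bounds by (intro mult_nonneg_nonneg) auto
  ultimately have "(1 + r) * (1 + a) < ((6 + 4 * golden) * a - (1 + golden)) * (1 + a)" using 2 by linarith
  then have "1 + r < (6 + 4 * golden) * a - (1 + golden)" using a by simp
  then have "1 + r < 6 * a + 4 * (golden * a) - (1 + golden)" by (simp add: algebra_simps)
  moreover have "golden * a \<le> 6181/10000 * a" using a golden_bounds by (intro mult_right_mono) auto
  \<comment> \<open>The slope is rounded down and the constant term up; \<open>a < 1\<close> makes
    this a weakening.\<close>
  ultimately show "r \<le> 423/50 * a - 13/5" using a golden_bounds by linarith
qed

text \<open>Here \<^term>\<open>a\<close>, \<^term>\<open>b\<close> are half the sum and half the difference of \<^term>\<open>m\<close>, \<^term>\<open>n\<close> in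
  \<open>star_area_bound\<close>, and \<^term>\<open>r\<close>, \<^term>\<open>d\<close> the sum and the difference of \<^term>\<open>y\<close>, \<^term>\<open>z\<close>.\<close>

lemma midpoint_ratio_bound:
  fixes a b r d :: real
  defines "P \<equiv> a\<^sup>2 - b\<^sup>2"
  defines "E \<equiv> a * (2 + r) + b * d + r"
  defines "D \<equiv> (P * (2 + r)\<^sup>2 - r\<^sup>2 + (1 - P) * d\<^sup>2) / 4"
  defines "M \<equiv> 2 * P * (1 - a) / (1 - P)"
  assumes a: "0 < a" and b: "\<bar>b\<bar> < a" "\<bar>b\<bar> < 1 - a" and r: "0 \<le> r"
    and E: "0 < E" and D: "0 < D"
  shows "M \<le> (2 * D / E)\<^sup>2 + (2 - 3 * golden) * (1 + r)"
    and "M = (2 * D / E)\<^sup>2 + (2 - 3 * golden) * (1 + r) \<Longrightarrow> a = golden \<and> b = 0 \<and> r = 2 * golden \<and> d = 0"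
proof -
  define h where "h = 2 * D / E"
  define T where "T = 2 - 3 * golden"
  have h: "0 < h" using D E by (simp add: h_def)
  have T: "0 < T" using golden_bounds by (simp add: T_def)
  have a1: "a < 1" using b by linarith
  have "b\<^sup>2 < a\<^sup>2" using b a by (simp add: abs_square_less_1 power2_strict_mono)
  then have P: "0 < P" "P \<le> a\<^sup>2" by (auto simp: P_def)
  have "a\<^sup>2 < 1" using a a1 by (simp add: power_less_one_iff)
  then have k: "0 < 1 - P" using P by linarith
  have "b\<^sup>2 \<le> (1 - a)\<^sup>2" using b by (intro power2_le_iff_abs_le[THEN iffD2]) auto
  then have k2: "1 - P \<le> 2 - 2 * a" by (simp add: P_def power2_eq_square algebra_simps)
  have key: "M \<le> h\<^sup>2 + T * (1 + r) \<and>
        (M = h\<^sup>2 + T * (1 + r) \<longrightarrow> a = golden \<and> b = 0 \<and> r = 2 * golden \<and> d = 0)"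
  proof (cases "M \<le> T * (1 + r)")
    case True
    moreover have "0 < h\<^sup>2" using h by simp
    ultimately show ?thesis by linarith
  next
    case False
    then have M: "T * (1 + r) < M" by simp
    note rad = radius_le_chord[OF a a1 P r M[unfolded T_def M_def]]
    \<comment> \<open>the tangent at \<^term>\<open>a = golden\<close> to \<^term>\<open>T / (1 - a)\<close>, the value of \<^term>\<open>h\<close> at which the bound for
      \<^term>\<open>b = 0\<close>, \<^term>\<open>d = 0\<close> is stationary in \<^term>\<open>r\<close>\<close>
    define m where "m = a - (2 * golden - 1)"
    have m: "0 < m" "m \<le> a - 47/200" using rad golden_bounds by (auto simp: m_def)
    \<comment> \<open>Replacing \<open>h\<^sup>2\<close> by its tangent bound
      \<open>2 * m * h - m\<^sup>2\<close> turns the goal into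
      \<open>0 \<le> 2 * m * h + kp\<close>.\<close>
    define kp where "kp = T * (1 + r) - M - m\<^sup>2"
    have sq: "h\<^sup>2 + T * (1 + r) - M = (h - m)\<^sup>2 + (2 * m * h + kp)"
      by (simp add: kp_def power2_eq_square algebra_simps)
    show ?thesis
    proof (cases "0 \<le> kp")
      case True
      have "0 < 2 * m * h" using m h by simp
      then show ?thesis using sq True by (smt (verit) zero_le_power2)
    next
      case False
      define k where "k = 1 - P"
      \<comment> \<open>For \<open>b = 0\<close> and \<open>d = 0\<close> one has
        \<open>E = F\<close> and \<open>4 * D = F * H\<close>, hence \<open>h = H / 2\<close>, and
        \<open>2 * m * h + kp\<close> reduces to \<open>B\<close>.\<close>
      define H where "H = 2 * a - (1 - a) * r"
      define B where "B = (a - golden)\<^sup>2 * ((a + (2 * golden - 1)) / (1 + a) + r)"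
      define F where "F = a * (2 + r) + r"
      have B0: "0 \<le> B" using a r golden_bounds unfolding B_def by (intro mult_nonneg_nonneg add_nonneg_nonneg divide_nonneg_nonneg) auto
      have F: "0 < F" using a r unfolding F_def by (intro add_pos_nonneg mult_pos_pos) auto
      have kp: "kp = B - m * H + 2 * b\<^sup>2 / ((1 + a) * k)"
      proof -
        have "2 * a\<^sup>2 / (1 + a) - M = 2 * b\<^sup>2 / ((1 + a) * k)"
          using a k unfolding M_def k_def P_def by (simp add: divide_simps) algebra
        moreover have "T * (1 + r) - 2 * a\<^sup>2 / (1 + a) - m\<^sup>2 = B - m * H"
          using a golden_sq unfolding T_def m_def B_def H_def by (simp add: divide_simps) algebra
        ultimately show ?thesis unfolding kp_def by linarith
      qed
      have "0 \<le> 2 * b\<^sup>2 / ((1 + a) * k)" using a k by (auto simp: k_def)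
      then have kpH: "\<bar>kp\<bar> \<le> m * H" using kp B0 False by linarith
      then have "0 \<le> m * H" by linarith
      then have H: "0 \<le> H" using m by (simp add: zero_le_mult_iff)
      have "H \<le> 2 * a" using a1 r by (simp add: H_def)
      then have H2: "H\<^sup>2 \<le> 4 * a\<^sup>2" using H power_mono[of H "2 * a" 2] by (simp add: power_mult_distrib)
      \<comment> \<open>The three terms are the gain from the \<open>b\<close>-dependence of
        \<open>M\<close>, the loss from \<open>P\<close> inside \<open>D\<close>, and a reserve used
        to complete the square in \<open>Z\<close>.\<close>
      define W where "W = 2 * F / ((1 + a) * k) - m * (2 + r)\<^sup>2 - m * H\<^sup>2 / (4 * k)"
      \<comment> \<open>Multiplied by \<open>(1 + a) * k\<close>, \<open>W\<close> is at least
        \<open>chord_gap a k r\<close>, by \<open>m \<le> a - 47/200\<close> and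
        \<open>H\<^sup>2 \<le> 4 * a\<^sup>2\<close>.\<close>
      have W: "0 < W"
      proof -
        have "0 < chord_gap a k r"
          using rad a1 k2 r P by (intro chord_gap_pos) (auto simp: k_def)
        also have "\<dots> \<le> 2 * F - (1 + a) * m * (k * (2 + r)\<^sup>2 + H\<^sup>2 / 4)"
        proof -
          have "(1 + a) * m * (k * (2 + r)\<^sup>2 + H\<^sup>2 / 4) \<le> (1 + a) * (a - 47/200) * (k * (2 + r)\<^sup>2 + a\<^sup>2)"
            using a m H2 k by (intro mult_mono add_mono) (auto simp: k_def)
          then show ?thesis by (simp add: chord_gap_def F_def algebra_simps)
        qed
        also have "\<dots> = (1 + a) * k * W"
          using a k unfolding W_def k_def[symmetric] by (simp add: divide_simps) algebra
        finally show ?thesis by (rule zero_less_mult_pos) (use a k in \<open>simp add: k_def\<close>)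
      qed
      \<comment> \<open>A quadratic form in \<open>d\<close> and \<open>b\<close> that absorbs every
        term containing \<open>d\<close>. Its discriminant is not positive because
        \<open>\<bar>kp\<bar> \<le> m * H\<close>.\<close>
      define Z where "Z = m * k * d\<^sup>2 + kp * b * d + b\<^sup>2 * (m * H\<^sup>2 / (4 * k))"
      have Z: "0 \<le> Z"
      proof -
        have "kp\<^sup>2 \<le> (m * H)\<^sup>2" using power_mono[OF kpH, of 2] by simp
        then have "0 \<le> (2 * m * k * d + kp * b)\<^sup>2 + b\<^sup>2 * ((m * H)\<^sup>2 - kp\<^sup>2)" by simp
        also have "\<dots> = 4 * m * k * Z"
          using k unfolding Z_def k_def[symmetric] by (simp add: divide_simps) algebra
        finally have "0 \<le> 4 * m * k * Z" .
        moreover have "0 < 4 * m * k" using m k by (simp add: k_def)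
        ultimately show ?thesis by (metis zero_le_mult_iff not_le)
      qed
      have split: "4 * m * D + kp * E = F * B + b\<^sup>2 * W + Z"
      proof -
        have "4 * m * D = m * ((a * (2 + r) + r) * H) - m * b\<^sup>2 * (2 + r)\<^sup>2 + m * k * d\<^sup>2"
          unfolding D_def k_def P_def H_def by (simp add: field_simps power2_eq_square)
        moreover have "kp * E = (B - m * H + 2 * b\<^sup>2 / ((1 + a) * k)) * F + kp * b * d"
          unfolding kp[symmetric] E_def F_def by (simp add: algebra_simps)
        moreover have "b\<^sup>2 * W = b\<^sup>2 * (2 * F / ((1 + a) * k)) - m * b\<^sup>2 * (2 + r)\<^sup>2 - b\<^sup>2 * (m * H\<^sup>2 / (4 * k))"
          unfolding W_def by (simp add: algebra_simps)
        ultimately show ?thesis unfolding Z_def F_def by (simp add: algebra_simps)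
      qed
      have eq: "2 * m * h + kp = (F * B + b\<^sup>2 * W + Z) / E"
        unfolding split[symmetric] h_def using E by (simp add: field_simps)
      have nn: "0 \<le> F * B" "0 \<le> b\<^sup>2 * W" using F B0 W by auto
      then have pos: "0 \<le> 2 * m * h + kp" unfolding eq using Z E by simp
      \<comment> \<open>Equality makes all three summands vanish: \<open>W > 0\<close> forces
        \<open>b = 0\<close>, then \<open>Z\<close> forces \<open>d = 0\<close> and \<open>B\<close>
        forces \<open>a = golden\<close>; finally \<open>h = m\<close> determines
        \<open>r\<close>.\<close>
      have "a = golden \<and> b = 0 \<and> r = 2 * golden \<and> d = 0" if M: "M = h\<^sup>2 + T * (1 + r)"
      proof -
        have hm: "(h - m)\<^sup>2 = 0" "2 * m * h + kp = 0" using sq pos M zero_le_power2[of "h - m"] by linarith+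
        then have "F * B + b\<^sup>2 * W + Z = 0" using eq E by simp
        then have 0: "F * B = 0" "b\<^sup>2 * W = 0" "Z = 0" using nn Z by linarith+
        have b: "b = 0" using 0 W by simp
        have d: "d = 0" using 0 b m k by (simp add: Z_def k_def)
        have "0 < (a + (2 * golden - 1)) / (1 + a) + r"
          using a r golden_bounds by (intro add_pos_nonneg divide_pos_pos) auto
        then have ag: "a = golden" using 0 F by (simp add: B_def)
        have "h = m" using hm by simp
        then have "2 * D = m * E" using E by (simp add: h_def field_simps)
        then have "F * H = F * (2 * m)"
          using b d unfolding D_def E_def F_def H_def P_def by (simp add: power2_eq_square algebra_simps)
        then have "H = 2 * m" using F by simp
        then have "(1 - golden) * r = 2 * (2 * golden - 1)" by (simp add: H_def m_def ag)
        then have "(1 - golden) * (r - 2 * golden) = 0" using golden_sq by algebra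
        then have "r = 2 * golden" using golden_bounds by simp
        then show ?thesis using ag b d by simp
      qed
      then show ?thesis using sq pos by (smt (verit) zero_le_power2)
    qed
  qed
  show "M \<le> (2 * D / E)\<^sup>2 + (2 - 3 * golden) * (1 + r)"
    using key by (simp add: h_def T_def)
  show "M = (2 * D / E)\<^sup>2 + (2 - 3 * golden) * (1 + r) \<Longrightarrow> a = golden \<and> b = 0 \<and> r = 2 * golden \<and> d = 0"
    using key by (simp add: h_def T_def)
qed

text \<open>AM-GM, \<open>4 * (F * G) \<le> (F + G)\<^sup>2\<close>, reduces this to
  \<open>midpoint_ratio_bound\<close> with \<open>E = F + G\<close>. Equality here makes that bound
  tight as well.\<close>

lemma star_area_bound:
  fixes m n y z :: real
  defines "D \<equiv> m * n * (1 + y) * (1 + z) - y * z"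
  defines "F \<equiv> n * (1 + z) + y" and "G \<equiv> m * (1 + y) + z"
  assumes m: "0 < m" "m < 1" and n: "0 < n" "n < 1" and yz: "0 < y" "0 < z" and D: "0 < D"
  shows "m * n * (2 - m - n) / (1 - m * n) - D\<^sup>2 / (F * G) \<le> (2 - 3 * golden) * (1 + y + z)"
    and "m * n * (2 - m - n) / (1 - m * n) - D\<^sup>2 / (F * G) = (2 - 3 * golden) * (1 + y + z)
      \<longleftrightarrow> m = golden \<and> n = golden \<and> y = golden \<and> z = golden"
proof -
  define a b where "a = (m + n) / 2" and "b = (m - n) / 2"
  have P: "a\<^sup>2 - b\<^sup>2 = m * n" by (simp add: a_def b_def field_simps power2_eq_square)
  have F: "0 < F" using n yz by (simp add: F_def add_pos_pos)
  have G: "0 < G" using m yz by (simp add: G_def add_pos_pos)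
  have E: "a * (2 + (y + z)) + b * (y - z) + (y + z) = F + G"
    by (simp add: a_def b_def F_def G_def field_simps)
  have D': "(m * n * (2 + (y + z))\<^sup>2 - (y + z)\<^sup>2 + (1 - m * n) * (y - z)\<^sup>2) / 4 = D"
    by (simp add: D_def field_simps power2_eq_square)
  have M: "2 * (m * n) * (1 - a) / (1 - m * n) = m * n * (2 - m - n) / (1 - m * n)"
  proof -
    have "2 * (m * n) * (1 - a) = m * n * (2 - m - n)" by (simp add: a_def field_simps)
    then show ?thesis by simp
  qed
  have ab: "0 < a" "\<bar>b\<bar> < a" "\<bar>b\<bar> < 1 - a" using m n by (auto simp: a_def b_def abs_if field_simps)
  note mid = midpoint_ratio_bound[of a b "y + z" "y - z", unfolded P E D' M, OF ab, folded add.assoc]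
  have le: "(2 * D / (F + G))\<^sup>2 \<le> D\<^sup>2 / (F * G)"
  proof -
    have "4 * (F * G) \<le> (F + G)\<^sup>2"
      using zero_le_power2[of "F - G"] by (simp add: power2_eq_square algebra_simps)
    then have "D\<^sup>2 / ((F + G)\<^sup>2 / 4) \<le> D\<^sup>2 / (F * G)"
      using F G by (intro divide_left_mono) auto
    then show ?thesis by (simp add: power_divide power_mult_distrib mult.commute)
  qed
  show le': "m * n * (2 - m - n) / (1 - m * n) - D\<^sup>2 / (F * G) \<le> (2 - 3 * golden) * (1 + y + z)"
    using mid(1) le F G D yz by simp
  show "m * n * (2 - m - n) / (1 - m * n) - D\<^sup>2 / (F * G) = (2 - 3 * golden) * (1 + y + z)
      \<longleftrightarrow> m = golden \<and> n = golden \<and> y = golden \<and> z = golden" (is "?L \<longleftrightarrow> ?R")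
  proof
    assume ?L
    then have "a = golden \<and> b = 0 \<and> y + z = 2 * golden \<and> y - z = 0"
      using mid le F G D yz by (smt (verit))
    then show ?R by (auto simp: a_def b_def)
  next
    assume ?R
    then have R: "m = golden" "n = golden" "y = golden" "z = golden" by auto
    have D1: "D = golden" unfolding D_def R using golden_sq by algebra
    have FG1: "F = 1 + golden" "G = 1 + golden" unfolding F_def G_def R using golden_sq by algebra+
    have "m * n * (2 - m - n) / (1 - m * n) = 2 * golden ^ 3"
      unfolding R using golden_sq golden_bounds by (simp add: divide_simps power2_eq_square) algebra
    moreover have "D\<^sup>2 / (F * G) = golden ^ 4"
      unfolding D1 FG1 using golden_sq golden_bounds by (simp add: divide_simps) algebra
    ultimately show ?L unfolding R using golden_sq by algebra
  qed
qed

section \<open>Area of convex pentagons\<close>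

lemma orient_frame:
  "orient (p + u1 *\<^sub>R e + v1 *\<^sub>R f) (p + u2 *\<^sub>R e + v2 *\<^sub>R f) (p + u3 *\<^sub>R e + v3 *\<^sub>R f)
     = ((u2 - u1) * (v3 - v1) - (v2 - v1) * (u3 - u1)) * cross2 e f"
  by (simp add: orient_def cross2_def algebra_simps)

lemma orient_rotate: "orient P Q R = orient Q R P"
  by (simp add: orient_def cross2_def algebra_simps)

lemma orient_rotate': "orient P Q R = orient R P Q"
  by (simp add: orient_def cross2_def algebra_simps)

lemma orient_refl [simp]: "orient P P Q = 0" "orient P Q P = 0" "orient P Q Q = 0"
  by (simp_all add: orient_def cross2_def)

lemma measure_triangle:
  fixes P Q R :: "real^2"
  shows "measure lebesgue (convex hull {P, Q, R}) = \<bar>orient P Q R\<bar> / 2"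
proof -
  have "measure lebesgue (convex hull {P, Q, R}) = measure lborel (convex hull {P, Q, R})"
    by (intro measure_completion) (simp add: finite_imp_compact_convex_hull compact_imp_closed)
  then show ?thesis by (simp add: content_triangle orient_def cross2_def abs_minus_commute mult.commute)
qed

text \<open>Barycentric coordinates are ratios of signed areas; clearing the denominator avoids any
  nondegeneracy hypothesis.\<close>

lemma barycentric_orient:
  "orient P Q R *\<^sub>R X = orient Q R X *\<^sub>R P + orient R P X *\<^sub>R Q + orient P Q X *\<^sub>R R"
  by (simp add: vec_eq_iff forall_2 orient_def cross2_def algebra_simps)

lemma in_triangleI:
  assumes "0 \<le> s * orient P Q X" "0 \<le> s * orient Q R X" "0 \<le> s * orient R P X" "0 < s * orient P Q R"
  shows "X \<in> convex hull {P, Q, R}"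
proof -
  define w where "w = s * orient P Q R"
  have sum: "s * orient Q R X + s * orient R P X + s * orient P Q X = w"
    by (simp add: w_def orient_def cross2_def algebra_simps)
  have "w *\<^sub>R X = (s * orient Q R X) *\<^sub>R P + (s * orient R P X) *\<^sub>R Q + (s * orient P Q X) *\<^sub>R R"
    using arg_cong[OF barycentric_orient[of P Q R X], of "scaleR s"]
    by (simp add: w_def scaleR_add_right)
  then have "X = (1 / w) *\<^sub>R ((s * orient Q R X) *\<^sub>R P + (s * orient R P X) *\<^sub>R Q + (s * orient P Q X) *\<^sub>R R)"
    using assms by (metis w_def divide_self_if less_irrefl one_add_one scaleR_one scaleR_scaleR times_divide_eq_left mult_1)
  then have "X = (s * orient Q R X / w) *\<^sub>R P + (s * orient R P X / w) *\<^sub>R Q + (s * orient P Q X / w) *\<^sub>R R"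
    by (simp add: scaleR_add_right)
  moreover have "s * orient Q R X / w + s * orient R P X / w + s * orient P Q X / w = 1"
    unfolding add_divide_distrib[symmetric] sum using assms(4)[folded w_def] by simp
  moreover have "0 \<le> s * orient Q R X / w" "0 \<le> s * orient R P X / w" "0 \<le> s * orient P Q X / w"
    using assms(1-3) assms(4)[folded w_def] by (auto intro: divide_nonneg_pos)
  ultimately show ?thesis unfolding convex_hull_3 by blast
qed

lemma convex_half_plane: "convex {X. 0 \<le> s * orient P Q X}"
proof -
  \<comment> \<open>The edge vector turned by a quarter turn, normal to the line.\<close>
  let ?n = "vector [- (Q - P)$2, (Q - P)$1] :: real^2"
  have "{X. 0 \<le> s * orient P Q X} = {X. inner (s *\<^sub>R ?n) X \<ge> - (s * orient P Q 0)}"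
    by (auto simp: orient_def cross2_def inner_vec_def sum_2 algebra_simps)
  then show ?thesis by (simp only: convex_halfspace_ge)
qed

lemma negligible_line:
  assumes "P \<noteq> Q" shows "negligible {X. orient P Q X = 0}"
proof -
  let ?n = "vector [- (Q - P)$2, (Q - P)$1] :: real^2"
  have "{X. orient P Q X = 0} = {X. inner ?n X = - orient P Q 0}"
    by (auto simp: orient_def cross2_def inner_vec_def sum_2 algebra_simps)
  moreover have "?n \<noteq> 0" using assms by (auto simp: vec_eq_iff forall_2)
  ultimately show ?thesis by (simp add: negligible_hyperplane)
qed

lemma hull_subset_half_plane:
  assumes "\<And>Y. Y \<in> S \<Longrightarrow> 0 \<le> s * orient P Q Y" and "X \<in> convex hull S"
  shows "0 \<le> s * orient P Q X"
  using hull_minimal[of S "{X. 0 \<le> s * orient P Q X}" convex] convex_half_plane assms by blast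

lemma negligible_across_line:
  assumes "\<And>X. X \<in> S \<Longrightarrow> 0 \<le> s * orient P Q X" "\<And>X. X \<in> T \<Longrightarrow> 0 \<le> - s * orient P Q X"
    and "P \<noteq> Q" "s \<noteq> 0"
  shows "negligible (S \<inter> T)"
proof (rule negligible_subset[OF negligible_line[OF \<open>P \<noteq> Q\<close>]])
  show "S \<inter> T \<subseteq> {X. orient P Q X = 0}"
  proof
    fix X assume "X \<in> S \<inter> T"
    then have "0 \<le> s * orient P Q X" "0 \<le> - s * orient P Q X" using assms(1,2) by blast+
    then show "X \<in> {X. orient P Q X = 0}" using \<open>s \<noteq> 0\<close> by simp
  qed
qed

text \<open>Any three vertices of a pentagon include two neighbours, so these are the side
  conditions of \<open>convex_pentagon\<close>, each triple listed once. With \<open>s\<close> equal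
  to 1 or -1 both orientations are treated together.\<close>

definition convex_cycle :: "real \<Rightarrow> real^2 \<Rightarrow> real^2 \<Rightarrow> real^2 \<Rightarrow> real^2 \<Rightarrow> real^2 \<Rightarrow> bool" where
  "convex_cycle s P0 P1 P2 P3 P4 \<longleftrightarrow>
     0 < s * orient P0 P1 P2 \<and> 0 < s * orient P0 P1 P3 \<and> 0 < s * orient P0 P1 P4 \<and>
     0 < s * orient P0 P2 P3 \<and> 0 < s * orient P0 P2 P4 \<and> 0 < s * orient P0 P3 P4 \<and>
     0 < s * orient P1 P2 P3 \<and> 0 < s * orient P1 P2 P4 \<and> 0 < s * orient P1 P3 P4 \<and>
     0 < s * orient P2 P3 P4"

text \<open>Fan triangulation from \<open>P0\<close>: the triangles overlap only on the lines of the
  diagonals \<open>P0 P2\<close> and \<open>P0 P3\<close>, and the sides of these on which a point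
  lies decide which triangle contains it.\<close>

lemma convex_cycle_area:
  assumes s: "\<bar>s\<bar> = 1" and cyc: "convex_cycle s P0 P1 P2 P3 P4"
  shows "measure lebesgue (convex hull {P0, P1, P2, P3, P4})
           = s * (orient P0 P1 P2 + orient P0 P2 P3 + orient P0 P3 P4) / 2"
proof -
  note pos = cyc[unfolded convex_cycle_def]
  have swap: "orient P R Q = - orient P Q R" for P Q R
    by (simp add: orient_def cross2_def algebra_simps)
  have flip: "orient Q P R = - orient P Q R" for P Q R
    by (simp add: orient_def cross2_def algebra_simps)
  have s0: "s \<noteq> 0" using s by auto
  have distinct: "P0 \<noteq> P2" "P0 \<noteq> P3" using pos by auto
  have tri: "measure lebesgue (convex hull {P, Q, R}) = s * orient P Q R / 2" if "0 < s * orient P Q R" for P Q R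
    using that s unfolding measure_triangle by (cases "s = 1") (auto simp: abs_if split: if_splits)
  have up2: "0 \<le> s * orient P0 P2 X" if "X \<in> convex hull {P0, P2, P3} \<union> convex hull {P0, P3, P4}" for X
    using that pos by (auto elim!: hull_subset_half_plane[rotated])
  have down2: "0 \<le> - s * orient P0 P2 X" if "X \<in> convex hull {P0, P1, P2}" for X
    using that pos swap[of P0 P2 P1] by (elim hull_subset_half_plane[rotated]) auto
  have up3: "0 \<le> s * orient P0 P3 X" if "X \<in> convex hull {P0, P3, P4}" for X
    using that pos by (elim hull_subset_half_plane[rotated]) auto
  have down3: "0 \<le> - s * orient P0 P3 X" if "X \<in> convex hull {P0, P2, P3}" for X
    using that pos swap[of P0 P3 P2] by (elim hull_subset_half_plane[rotated]) auto
  have "convex hull {P0, P1, P2} \<union> convex hull {P0, P2, P3} \<union> convex hull {P0, P3, P4}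
          = convex hull {P0, P1, P2, P3, P4}" (is "?T = ?K")
  proof
    show "?T \<subseteq> ?K" by (intro Un_least hull_mono) auto
    show "?K \<subseteq> ?T"
    proof
      fix X assume X: "X \<in> ?K"
      have e01: "0 \<le> s * orient P0 P1 X" using X pos by (elim hull_subset_half_plane[rotated]) auto
      have e12: "0 \<le> s * orient P1 P2 X" using X pos orient_rotate[of P0 P1 P2] by (elim hull_subset_half_plane[rotated]) auto
      have e23: "0 \<le> s * orient P2 P3 X" using X pos orient_rotate[of P0 P2 P3] orient_rotate[of P1 P2 P3]
        by (elim hull_subset_half_plane[rotated]) auto
      have e34: "0 \<le> s * orient P3 P4 X"
        using X pos orient_rotate[of P0 P3 P4] orient_rotate[of P1 P3 P4] orient_rotate[of P2 P3 P4]
        by (elim hull_subset_half_plane[rotated]) auto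
      have e40: "0 \<le> s * orient P4 P0 X"
        using X pos orient_rotate[of P4 P0 P1] orient_rotate[of P4 P0 P2] orient_rotate[of P4 P0 P3]
        by (elim hull_subset_half_plane[rotated]) auto
      consider "s * orient P0 P2 X \<le> 0" | "0 \<le> s * orient P0 P2 X" "s * orient P0 P3 X \<le> 0" | "0 \<le> s * orient P0 P3 X"
        by linarith
      then show "X \<in> ?T"
      proof cases
        case 1
        then have "0 \<le> s * orient P2 P0 X" by (simp add: flip[of P2 P0])
        then have "X \<in> convex hull {P0, P1, P2}" using e01 e12 pos by (intro in_triangleI) auto
        then show ?thesis by blast
      next
        case 2
        then have "0 \<le> s * orient P3 P0 X" by (simp add: flip[of P3 P0])
        then have "X \<in> convex hull {P0, P2, P3}" using 2 e23 pos by (intro in_triangleI) auto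
        then show ?thesis by blast
      next
        case 3
        then have "X \<in> convex hull {P0, P3, P4}" using e34 e40 pos by (intro in_triangleI) auto
        then show ?thesis by blast
      qed
    qed
  qed
  moreover have "negligible (convex hull {P0, P2, P3} \<inter> convex hull {P0, P1, P2})"
    "negligible (convex hull {P0, P3, P4} \<inter> convex hull {P0, P1, P2})"
    by (rule negligible_across_line[OF _ down2 distinct(1) s0]; use up2 in blast)+
  moreover have "negligible (convex hull {P0, P3, P4} \<inter> convex hull {P0, P2, P3})"
    by (rule negligible_across_line[OF up3 down3 distinct(2) s0])
  ultimately have "measure lebesgue (convex hull {P0, P1, P2, P3, P4})
      = measure lebesgue (convex hull {P0, P1, P2}) + measure lebesgue (convex hull {P0, P2, P3})
        + measure lebesgue (convex hull {P0, P3, P4})"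
    by (intro measure_Un3_negligible) (auto simp: Int_commute finite_imp_compact_convex_hull lmeasurable_compact)
  then show ?thesis using pos by (simp add: tri add_divide_distrib distrib_left)
qed

section \<open>Affine coordinates\<close>

text \<open>\<open>line_inter\<close> is a definite description, so the common point must be unique.
  Taking \<open>cross2\<close> with \<open>S - R\<close> shows that any other common point has the
  same parameter on the first line.\<close>

lemma line_inter_eq:
  assumes X: "X = P + a *\<^sub>R (Q - P)" "X = R + b *\<^sub>R (S - R)" and nz: "cross2 (Q - P) (S - R) \<noteq> 0"
  shows "line_inter P Q R S = X"
  unfolding line_inter_def
proof (rule the_equality)
  have line: "affine hull {P, Q} = {P + u *\<^sub>R (Q - P) | u. True}" for P Q :: "real^2"
    unfolding affine_hull_2_alt by auto
  show "X \<in> affine hull {P, Q} \<and> X \<in> affine hull {R, S}"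
    using X unfolding line by blast
  fix Y assume "Y \<in> affine hull {P, Q} \<and> Y \<in> affine hull {R, S}"
  then obtain a' b' where Y: "Y = P + a' *\<^sub>R (Q - P)" "Y = R + b' *\<^sub>R (S - R)"
    unfolding line by blast
  have "(a' - a) *\<^sub>R (Q - P) = Y - X" unfolding X(1) Y(1) by (simp add: algebra_simps)
  also have "\<dots> = (b' - b) *\<^sub>R (S - R)" unfolding X(2) Y(2) by (simp add: algebra_simps)
  finally have "cross2 ((a' - a) *\<^sub>R (Q - P)) (S - R) = cross2 ((b' - b) *\<^sub>R (S - R)) (S - R)" by simp
  then have "(a' - a) * cross2 (Q - P) (S - R) = 0" by (simp add: cross2_def algebra_simps)
  then show "Y = X" using nz X Y by simp
qed

text \<open>Cramer's rule in the basis \<open>e\<close>, \<open>f\<close>.\<close>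

lemma frame_coordinates:
  fixes V e f :: "real^2"
  assumes "cross2 e f \<noteq> 0"
  shows "V = (cross2 V f / cross2 e f) *\<^sub>R e + (cross2 e V / cross2 e f) *\<^sub>R f"
proof -
  have "cross2 e f *\<^sub>R V = cross2 V f *\<^sub>R e + cross2 e V *\<^sub>R f"
    by (simp add: vec_eq_iff forall_2 cross2_def algebra_simps)
  then have "(1 / cross2 e f) *\<^sub>R (cross2 e f *\<^sub>R V) = (1 / cross2 e f) *\<^sub>R (cross2 V f *\<^sub>R e + cross2 e V *\<^sub>R f)"
    by simp
  then show ?thesis using assms by (simp add: scaleR_add_right)
qed

lemma frame_coordinates_unique:
  fixes e f :: "real^2"
  assumes "cross2 e f \<noteq> 0" "u *\<^sub>R e + v *\<^sub>R f = u' *\<^sub>R e + v' *\<^sub>R f"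
  shows "u = u' \<and> v = v'"
proof -
  have "cross2 (u *\<^sub>R e + v *\<^sub>R f) f = cross2 (u' *\<^sub>R e + v' *\<^sub>R f) f"
    "cross2 e (u *\<^sub>R e + v *\<^sub>R f) = cross2 e (u' *\<^sub>R e + v' *\<^sub>R f)" using assms(2) by simp_all
  then have "u * cross2 e f = u' * cross2 e f" "v * cross2 e f = v' * cross2 e f"
    by (simp_all add: cross2_def algebra_simps)
  then show ?thesis using assms(1) by simp
qed

text \<open>\<open>(X, Y)\<close> is where the line through \<open>(m, 0)\<close> and
  \<open>(0, 1)\<close> meets the line through \<open>(1, 0)\<close> and \<open>(0, n)\<close>. The
  area is that of the quadrilateral with corners the origin, \<open>(m, 0)\<close>,
  \<open>(X, Y)\<close>, \<open>(0, n)\<close>, less the corner triangle with legs \<open>h\<close>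
  and \<open>k\<close>.\<close>

lemma inner_star_area:
  fixes p e f :: "real^2" and h k m n :: real
  defines "V \<equiv> \<lambda>u v. p + u *\<^sub>R e + v *\<^sub>R f"
  defines "X \<equiv> m * (1 - n) / (1 - m * n)" and "Y \<equiv> n * (1 - m) / (1 - m * n)"
  assumes s: "\<bar>s\<bar> = 1" "0 < s * cross2 e f"
    and h: "0 < h" "h < m" "m < 1" and k: "0 < k" "k < n" "n < 1"
  shows "measure lebesgue (convex hull {V 0 k, V h 0, V m 0, V X Y, V 0 n})
           = s * cross2 e f / 2 * (m * n * (2 - m - n) / (1 - m * n) - h * k)"
proof -
  have m: "0 < m" and n: "0 < n" using h k by auto
  have mn: "m * n < 1" using h k m n mult_strict_mono[of m 1 n 1] by simp
  have X: "0 < X" and Y: "0 < Y" using h k m n mn by (auto simp: X_def Y_def)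
  have XY: "X = m * (1 - Y)" "Y = n * (1 - X)"
    using mn by (simp_all add: X_def Y_def divide_simps) (simp_all add: algebra_simps)
  have "X + Y < 1"
  proof -
    have "Y < 1 - X" using XY n k Y by (smt (verit) mult_le_cancel_right1 zero_less_mult_iff)
    then show ?thesis by simp
  qed
  \<comment> \<open>By \<open>XY\<close> the sum is \<open>2 - (X + Y)\<close>, and smaller
    intercepts only increase it. The digits in \<open>b013\<close> and its companions name the
    vertex triple whose orientation is meant.\<close>
  then have "1 < X / m + Y / n" using XY m n by (smt (verit) nonzero_mult_div_cancel_left)
  also have "\<dots> \<le> X / h + Y / k" using X Y h k by (intro add_mono divide_left_mono) auto
  finally have b013: "0 < h * (Y - k) + k * X" using h k by (simp add: field_simps)
  have b023: "0 < m * (Y - k) + k * X"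
  proof -
    have "m * (Y - k) + k * X = m * Y * (1 - k)" unfolding XY(1) by (simp add: algebra_simps)
    then show ?thesis using m Y k by simp
  qed
  have b134: "0 < (X - h) * n + Y * h"
  proof -
    have "(X - h) * n + Y * h = n * X * (1 - h)" unfolding XY(2) by (simp add: algebra_simps)
    then show ?thesis using n X h by simp
  qed
  have b234: "0 < (X - m) * n + Y * m"
  proof -
    have "(X - m) * n + Y * m = n * X * (1 - m)" unfolding XY(2) by (simp add: algebra_simps)
    then show ?thesis using n X h by simp
  qed
  have or: "orient (V u1 v1) (V u2 v2) (V u3 v3)
      = ((u2 - u1) * (v3 - v1) - (v2 - v1) * (u3 - u1)) * cross2 e f" for u1 v1 u2 v2 u3 v3
    unfolding V_def by (rule orient_frame)
  have pos: "0 < s * (t * cross2 e f)" if "0 < t" for t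
    using mult_pos_pos[OF that s(2)] by (simp add: mult_ac)
  have "convex_cycle s (V 0 k) (V h 0) (V m 0) (V X Y) (V 0 n)"
    unfolding convex_cycle_def or
    using b013 b023 b134 b234 h k m n X Y
    by (intro conjI pos) (auto simp: algebra_simps mult_strict_left_mono)
  from convex_cycle_area[OF s(1) this]
  have "measure lebesgue (convex hull {V 0 k, V h 0, V m 0, V X Y, V 0 n})
          = s * cross2 e f / 2 * (m * Y + n * X - h * k)"
    unfolding or by (simp add: field_simps)
  also have "m * Y + n * X = m * n * (2 - m - n) / (1 - m * n)"
    unfolding X_def Y_def by (simp add: add_divide_distrib[symmetric] algebra_simps)
  finally show ?thesis .
qed

section \<open>Regular pentagons\<close>

text \<open>With \<open>t = 2 * pi / 5\<close>, \<open>3 * t\<close> and \<open>2 * t\<close> add up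
  to a full turn, so \<open>cos (3 * t) = cos (2 * t)\<close>. Of the three roots of the resulting
  cubic only \<open>golden / 2\<close> lies strictly between 0 and 1.\<close>

lemma two_cos_golden: "2 * cos (2 * pi / 5) = golden"
proof -
  define c where "c = cos (2 * pi / 5)"
  have c0: "0 < c" unfolding c_def by (rule cos_gt_zero_pi) (use pi_gt_zero in linarith)+
  have c1: "c < 1" unfolding c_def using cos_monotone_0_pi[of 0 "2 * pi / 5"] by simp
  have "cos (3 * (2 * pi / 5)) = cos (2 * pi - 2 * (2 * pi / 5))" by (simp add: field_simps)
  then have "4 * c ^ 3 - 3 * c = 2 * c\<^sup>2 - 1"
    unfolding cos_treble_cos cos_2pi_minus cos_double_cos c_def .
  then have "(c - 1) * ((2 * c - golden) * (2 * c + 1 + golden)) = 0" using golden_sq by algebra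
  then show ?thesis using c0 c1 golden_bounds by (simp add: c_def)
qed

text \<open>Measured from the centre, \<open>golden\<close> times a vertex is the sum of its two
  neighbours, since \<open>golden = 2 * cos w\<close>. The claims combine this relation at the
  vertices 1, 3 and 4.\<close>

lemma regular_pentagon_recurrence:
  assumes "regular_pentagon P"
  shows "P 2 - P 1 = (P 3 - P 1) - golden *\<^sub>R (P 4 - P 1)"
    and "P 0 - P 1 = (P 4 - P 1) - golden *\<^sub>R (P 3 - P 1)"
proof -
  obtain c r t s where s: "s = 1 \<or> s = -1" and P: "\<And>k. k < 5 \<Longrightarrow> P k = c + (\<chi> j. if j = 1
      then r * cos (t + s * 2 * pi * real k / 5) else r * sin (t + s * 2 * pi * real k / 5))"
    using assms unfolding regular_pentagon_def by blast
  define w where "w = s * (2 * pi / 5)"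
  have ang: "t + s * 2 * pi * real k / 5 = t + real k * w" for k by (simp add: w_def)
  have P': "P k = c + (\<chi> j. if j = 1 then r * cos (t + real k * w) else r * sin (t + real k * w))" if "k < 5" for k
    using P[OF that] unfolding ang .
  have w: "golden = 2 * cos w" using s by (auto simp: w_def two_cos_golden)
  have c: "golden * cos x = cos (x - w) + cos (x + w)" for x
    by (simp add: w cos_add cos_diff)
  have d: "golden * sin x = sin (x - w) + sin (x + w)" for x
    by (simp add: w sin_add sin_diff)
  have w5: "t + 5 * w = t + s * (2 * pi)" by (simp add: w_def)
  have per: "cos (t + 5 * w) = cos t" "sin (t + 5 * w) = sin t"
    unfolding w5 using s by (auto simp: cos_diff sin_diff)
  have c': "golden * cos (t + w) = cos t + cos (t + 2 * w)"
      "golden * cos (t + 3 * w) = cos (t + 2 * w) + cos (t + 4 * w)"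
      "golden * cos (t + 4 * w) = cos (t + 3 * w) + cos t"
    using c[of "t + w"] c[of "t + 3 * w"] c[of "t + 4 * w"] per by (simp_all add: algebra_simps)
  have d': "golden * sin (t + w) = sin t + sin (t + 2 * w)"
      "golden * sin (t + 3 * w) = sin (t + 2 * w) + sin (t + 4 * w)"
      "golden * sin (t + 4 * w) = sin (t + 3 * w) + sin t"
    using d[of "t + w"] d[of "t + 3 * w"] d[of "t + 4 * w"] per by (simp_all add: algebra_simps)
  show "P 2 - P 1 = (P 3 - P 1) - golden *\<^sub>R (P 4 - P 1)"
    "P 0 - P 1 = (P 4 - P 1) - golden *\<^sub>R (P 3 - P 1)"
    using arg_cong[OF c'(1), of "\<lambda>x. r * x"] arg_cong[OF c'(2), of "\<lambda>x. r * x"] arg_cong[OF c'(3), of "\<lambda>x. r * x"]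
      arg_cong[OF d'(1), of "\<lambda>x. r * x"] arg_cong[OF d'(2), of "\<lambda>x. r * x"] arg_cong[OF d'(3), of "\<lambda>x. r * x"]
    by (simp_all add: P' vec_eq_iff forall_2 algebra_simps)
qed

definition column_matrix :: "real^2 \<Rightarrow> real^2 \<Rightarrow> real^2^2" where
  "column_matrix u v = (\<chi> i j. if j = 1 then u $ i else v $ i)"

lemma det_column_matrix: "det (column_matrix u v) = cross2 u v"
  by (simp add: det_2 column_matrix_def cross2_def)

lemma column_matrix_mult: "column_matrix u v *v w = w $ 1 *\<^sub>R u + w $ 2 *\<^sub>R v"
  by (simp add: column_matrix_def matrix_vector_mult_def vec_eq_iff forall_2 sum_2)

lemma ex_invertible_matrix_mapping:
  fixes u v e f :: "real^2"
  assumes "cross2 u v \<noteq> 0" "cross2 e f \<noteq> 0"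
  obtains M :: "real^2^2" where "invertible M" "M *v u = e" "M *v v = f"
proof -
  let ?N = "column_matrix u v" and ?L = "column_matrix e f"
  have inv: "invertible ?N" "invertible ?L" using assms by (simp_all add: invertible_det_nz det_column_matrix)
  then obtain N' where N': "?N ** N' = mat 1" "N' ** ?N = mat 1" unfolding invertible_def by blast
  then have "invertible N'" unfolding invertible_def by blast
  then have "invertible (?L ** N')" using inv by (intro invertible_mult)
  moreover have M: "(?L ** N') *v (?N *v x) = ?L *v x" for x
    by (simp add: matrix_vector_mul_assoc N' flip: matrix_mul_assoc)
  have "(?L ** N') *v u = e" "(?L ** N') *v v = f"
    using M[of "vector [1, 0]"] M[of "vector [0, 1]"] by (simp_all add: column_matrix_mult)
  ultimately show thesis using that by blast
qed

text \<open>Affine maps preserve the two relations. Conversely, an affine map can match the vertices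
  1, 3, 4 with those of a regular pentagon, and the relations then fix the other two
  vertices.\<close>

lemma affine_regular_pentagon_iff:
  assumes nz: "cross2 (A 3 - A 1) (A 4 - A 1) \<noteq> 0"
  shows "affine_regular_pentagon A \<longleftrightarrow>
    A 2 - A 1 = (A 3 - A 1) - golden *\<^sub>R (A 4 - A 1) \<and> A 0 - A 1 = (A 4 - A 1) - golden *\<^sub>R (A 3 - A 1)"
    (is "?L \<longleftrightarrow> ?R")
proof
  assume ?L
  then obtain P M t where P: "regular_pentagon P" and A: "\<And>k. k < 5 \<Longrightarrow> A k = M *v P k + t"
    unfolding affine_regular_pentagon_def by blast
  have dif: "A i - A j = M *v (P i - P j)" if "i < 5" "j < 5" for i j
    using that by (simp add: A matrix_vector_mult_diff_distrib)
  show ?R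
    using regular_pentagon_recurrence[OF P]
    by (simp add: dif matrix_vector_mult_diff_distrib matrix_vector_mult_scaleR)
next
  assume R: ?R
  define P :: "nat \<Rightarrow> real^2" where "P k = (\<chi> j. if j = 1 then cos (2 * pi * real k / 5) else sin (2 * pi * real k / 5))" for k
  have P: "regular_pentagon P"
    unfolding regular_pentagon_def
    by (rule exI[of _ 0], rule exI[of _ 1], rule exI[of _ 0], rule exI[of _ 1]) (simp add: P_def vec_eq_iff)
  \<comment> \<open>In the standard pentagon \<open>P 4 - P 1\<close> is vertical and nonzero, so
    the frame is nondegenerate once \<open>P 3\<close> and \<open>P 1\<close> have different first
    coordinates.\<close>
  have c: "cos (8 * pi / 5) = cos (2 * pi / 5)" "sin (8 * pi / 5) = - sin (2 * pi / 5)"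
    using cos_2pi_minus[of "2 * pi / 5"] sin_2pi_minus[of "2 * pi / 5"] by (simp_all add: field_simps)
  have "cos (6 * pi / 5) = cos (2 * (2 * pi / 5))"
    using cos_2pi_minus[of "2 * (2 * pi / 5)"] by (simp add: field_simps)
  also have "\<dots> = golden\<^sup>2 / 2 - 1" unfolding cos_double_cos two_cos_golden[symmetric] by (simp add: power_mult_distrib)
  finally have c3: "cos (6 * pi / 5) < cos (2 * pi / 5)"
    using two_cos_golden golden_sq golden_bounds by linarith
  have "0 < sin (2 * pi / 5)" by (intro sin_gt_zero) (use pi_gt_zero in linarith)+
  then have "cross2 (P 3 - P 1) (P 4 - P 1) \<noteq> 0"
    using c3 by (simp add: cross2_def P_def c)
  from ex_invertible_matrix_mapping[OF this nz] obtain M where M: "invertible M"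
    "M *v (P 3 - P 1) = A 3 - A 1" "M *v (P 4 - P 1) = A 4 - A 1" by blast
  have "M *v (P 2 - P 1) = A 2 - A 1" "M *v (P 0 - P 1) = A 0 - A 1"
    unfolding regular_pentagon_recurrence[OF P] matrix_vector_mult_diff_distrib[of M "P 3 - P 1"]
      matrix_vector_mult_diff_distrib[of M "P 4 - P 1"] matrix_vector_mult_scaleR M(2,3) using R by simp_all
  then have "A k = M *v P k + (A 1 - M *v P 1)" if "k < 5" for k
  proof -
    have "k = 0 \<or> k = 1 \<or> k = 2 \<or> k = 3 \<or> k = 4" using that by linarith
    then show ?thesis
      using M(2,3) \<open>M *v (P 2 - P 1) = A 2 - A 1\<close> \<open>M *v (P 0 - P 1) = A 0 - A 1\<close>
      by (auto simp: matrix_vector_mult_diff_distrib algebra_simps)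
  qed
  then show ?L unfolding affine_regular_pentagon_def using P M(1) by blast
qed

section \<open>The diagonal pentagon\<close>

lemma convex_pentagon_cycle:
  assumes "convex_pentagon A"
  obtains s where "\<bar>s\<bar> = 1" "convex_cycle s (A 0) (A 1) (A 2) (A 3) (A 4)"
proof -
  have *: "convex_cycle s (A 0) (A 1) (A 2) (A 3) (A 4)"
    if h: "\<And>i j. i < 5 \<Longrightarrow> j < 5 \<Longrightarrow> j \<noteq> i \<Longrightarrow> j \<noteq> (i+1) mod 5 \<Longrightarrow> 0 < s * orient (A i) (A ((i+1) mod 5)) (A j)" for s
    \<comment> \<open>One pair of a side and a vertex for each of the ten triples.\<close>
    using h[of 0 2] h[of 0 3] h[of 0 4] h[of 1 3] h[of 1 4] h[of 2 4] h[of 2 0] h[of 3 0] h[of 3 1] h[of 4 2]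
    unfolding convex_cycle_def orient_rotate[of "A 0" "A 2" "A 3"] orient_rotate[of "A 0" "A 3" "A 4"]
      orient_rotate[of "A 1" "A 3" "A 4"] orient_rotate'[of "A 0" "A 2" "A 4"]
    by (simp add: numeral_2_eq_2)
  show thesis
    using assms unfolding convex_pentagon_def
  proof
    assume "\<forall>i<5. \<forall>j<5. j \<noteq> i \<and> j \<noteq> (i+1) mod 5 \<longrightarrow> orient (A i) (A ((i+1) mod 5)) (A j) > 0"
    then show thesis by (intro that[of 1] *) auto
  next
    assume "\<forall>i<5. \<forall>j<5. j \<noteq> i \<and> j \<noteq> (i+1) mod 5 \<longrightarrow> orient (A i) (A ((i+1) mod 5)) (A j) < 0"
    then show thesis by (intro that[of "-1"] *) auto
  qed
qed

lemma lessThan_5: "{..<5::nat} = {0, 1, 2, 3, 4}"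
  by auto

lemma inner_pentagon_vertices:
  "inner_pentagon A 0 = line_inter (A 4) (A 1) (A 0) (A 2)"
  "inner_pentagon A 1 = line_inter (A 0) (A 2) (A 1) (A 3)"
  "inner_pentagon A 2 = line_inter (A 1) (A 3) (A 2) (A 4)"
  "inner_pentagon A 3 = line_inter (A 2) (A 4) (A 3) (A 0)"
  "inner_pentagon A 4 = line_inter (A 3) (A 0) (A 4) (A 1)"
  by (simp_all add: inner_pentagon_def numeral_2_eq_2)

text \<open>Affine coordinates with \<^term>\<open>A 1\<close>, \<^term>\<open>A 3\<close>, \<^term>\<open>A 4\<close> at \<open>(0, 0)\<close>, \<open>(1, 0)\<close>, \<open>(0, 1)\<close>: then \<^term>\<open>A 2\<close> is
  \<open>(m(1+y), -y)\<close>, \<^term>\<open>A 0\<close> is \<open>(-z, n(1+z))\<close>, and \<open>(m, 0)\<close>, \<open>(0, n)\<close> are inner vertices. The inner pentagon is the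
  quadrilateral cut from the first quadrant by two diagonals, minus the triangle cut off by the diagonal
  from \<^term>\<open>A 0\<close> to \<^term>\<open>A 2\<close>.\<close>

lemma pentagon_normal_form:
  assumes "convex_pentagon A"
  obtains c m n y z where "0 < c" "0 < m" "m < 1" "0 < n" "n < 1" "0 < y" "0 < z"
    "0 < m * n * (1 + y) * (1 + z) - y * z"
    "pent_area A = c * (1 + y + z)"
    "pent_area (inner_pentagon A) = c * (m * n * (2 - m - n) / (1 - m * n)
       - (m * n * (1 + y) * (1 + z) - y * z)\<^sup>2 / ((n * (1 + z) + y) * (m * (1 + y) + z)))"
    "affine_regular_pentagon A \<longleftrightarrow> m = golden \<and> n = golden \<and> y = golden \<and> z = golden"
proof -
  obtain s where s: "\<bar>s\<bar> = 1" and cyc: "convex_cycle s (A 0) (A 1) (A 2) (A 3) (A 4)"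
    using convex_pentagon_cycle[OF assms] .
  define e f where "e = A 3 - A 1" and "f = A 4 - A 1"
  define V where "V u v = A 1 + u *\<^sub>R e + v *\<^sub>R f" for u v
  define d where "d = cross2 e f"
  have or: "orient (V u1 v1) (V u2 v2) (V u3 v3) = ((u2 - u1) * (v3 - v1) - (v2 - v1) * (u3 - u1)) * d"
    for u1 v1 u2 v2 u3 v3
    unfolding V_def d_def by (rule orient_frame)
  have sd: "0 < s * d" using cyc by (simp add: convex_cycle_def d_def e_def f_def orient_def)
  then have d: "d \<noteq> 0" "cross2 e f \<noteq> 0" by (auto simp: d_def)
  define x where "x = cross2 (A 2 - A 1) f / d"
  define y where "y = - (cross2 e (A 2 - A 1) / d)"
  define z where "z = - (cross2 (A 0 - A 1) f / d)"
  define w where "w = cross2 e (A 0 - A 1) / d"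
  have A: "A 0 = V (-z) w" "A 1 = V 0 0" "A 2 = V x (-y)" "A 3 = V 1 0" "A 4 = V 0 1"
    using frame_coordinates[OF d(2), of "A 0 - A 1"] frame_coordinates[OF d(2), of "A 2 - A 1"]
    by (simp_all add: V_def x_def y_def z_def w_def d_def) (simp_all add: e_def f_def algebra_simps)
  have pos: "0 < s * (t * d) \<longleftrightarrow> 0 < t" for t
    using sd by (metis mult.left_commute mult.commute zero_less_mult_pos mult_pos_pos)
  define D where "D = x * w - y * z"
  \<comment> \<open>Each inequality is the orientation of one vertex triple: \<open>0 < D\<close>
    comes from 0, 1, 2, \<open>D < y + w\<close> from 0, 2, 3 and \<open>D < x + z\<close> from 0,
    2, 4. The last two yield \<open>k < n\<close> and \<open>h < m\<close>.\<close>
  have b: "0 < x" "0 < y" "0 < z" "0 < w" "x < 1 + y" "w < 1 + z" "0 < D" "D < x + z" "D < y + w"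
    using cyc unfolding convex_cycle_def A or pos by (auto simp: D_def algebra_simps)
  define m n where "m = x / (1 + y)" and "n = w / (1 + z)"
  have x: "x = m * (1 + y)" and w: "w = n * (1 + z)" using b by (simp_all add: m_def n_def)
  have D: "D = m * n * (1 + y) * (1 + z) - y * z" by (simp add: D_def x w)
  have mn: "0 < m" "m < 1" "0 < n" "n < 1" using b by (simp_all add: m_def n_def)
  have "m * n < 1" using mn mult_strict_mono[of m 1 n 1] by simp
  \<comment> \<open>The intercepts of the diagonal from \<open>A 0\<close> to \<open>A 2\<close> on
    the two axes.\<close>
  define h k where "h = D / (y + w)" and "k = D / (x + z)"
  have hk: "0 < h" "0 < k" using b by (simp_all add: h_def k_def)
  have hm: "h < m"
  proof -
    have "x * (y + w) - D * (1 + y) = y * (x + z - D)" by (simp add: D_def algebra_simps)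
    moreover have "0 < y * (x + z - D)" using b by simp
    ultimately have "D * (1 + y) < x * (y + w)" by linarith
    then show ?thesis using b by (simp add: h_def m_def divide_simps mult.commute)
  qed
  have kn: "k < n"
  proof -
    have "w * (x + z) - D * (1 + z) = z * (y + w - D)" by (simp add: D_def algebra_simps)
    moreover have "0 < z * (y + w - D)" using b by simp
    ultimately have "D * (1 + z) < w * (x + z)" by linarith
    then show ?thesis using b by (simp add: k_def n_def divide_simps mult.commute)
  qed
  define X Y where "X = m * (1 - n) / (1 - m * n)" and "Y = n * (1 - m) / (1 - m * n)"
  have inter: "line_inter (V u1 v1) (V u2 v2) (V u3 v3) (V u4 v4) = V u v"
    if "u = u1 + a * (u2 - u1)" "v = v1 + a * (v2 - v1)" "u = u3 + b * (u4 - u3)" "v = v3 + b * (v4 - v3)"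
      and nz: "(u2 - u1) * (v4 - v3) - (v2 - v1) * (u4 - u3) \<noteq> 0"
    for u v u1 v1 u2 v2 u3 v3 u4 v4 a b
  proof (rule line_inter_eq[where a = a and b = b])
    show "V u v = V u1 v1 + a *\<^sub>R (V u2 v2 - V u1 v1)"
      unfolding V_def that(1,2) by (simp add: algebra_simps)
    show "V u v = V u3 v3 + b *\<^sub>R (V u4 v4 - V u3 v3)"
      unfolding V_def that(3,4) by (simp add: algebra_simps)
    have "cross2 (V u2 v2 - V u1 v1) (V u4 v4 - V u3 v3) = ((u2 - u1) * (v4 - v3) - (v2 - v1) * (u4 - u3)) * d"
      unfolding V_def d_def by (simp add: cross2_def algebra_simps)
    then show "cross2 (V u2 v2 - V u1 v1) (V u4 v4 - V u3 v3) \<noteq> 0" using nz d by simp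
  qed
  have B0: "inner_pentagon A 0 = V 0 k"
    unfolding inner_pentagon_vertices A
    by (rule inter[where a = "1 - k" and b = "z / (x + z)"]) (use b mn \<open>m * n < 1\<close> in \<open>auto simp: k_def D_def field_simps\<close>)
  have B1: "inner_pentagon A 1 = V h 0"
    unfolding inner_pentagon_vertices A
    by (rule inter[where a = "w / (y + w)" and b = h]) (use b mn \<open>m * n < 1\<close> in \<open>auto simp: h_def D_def field_simps\<close>)
  have B2: "inner_pentagon A 2 = V m 0"
    unfolding inner_pentagon_vertices A
    by (rule inter[where a = m and b = "y / (1 + y)"]) (use b mn \<open>m * n < 1\<close> in \<open>auto simp: m_def field_simps\<close>)
  have B3: "inner_pentagon A 3 = V X Y"
    unfolding inner_pentagon_vertices A
  proof (rule inter)
    have mn1: "1 - m * n \<noteq> 0" using \<open>m * n < 1\<close> by simp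
    have "X + m * Y = m" "Y + n * X = n"
      using mn1 by (simp_all add: X_def Y_def divide_simps) (simp_all add: algebra_simps)
    then have XY: "X = m * (1 - Y)" "Y = n * (1 - X)" by (simp_all add: algebra_simps)
    \<comment> \<open>Position of the vertex on its two diagonals, measured from \<open>A 4\<close>
      towards \<open>A 2\<close> and from \<open>A 3\<close> towards \<open>A 0\<close>.\<close>
    define q t where "q = (1 - Y) / (1 + y)" and "t = (1 - X) / (1 + z)"
    have q: "q * (1 + y) = 1 - Y" and t: "t * (1 + z) = 1 - X" using b by (simp_all add: q_def t_def)
    show "X = x + (1 - q) * (0 - x)" using XY(1) q x by algebra
    show "Y = - y + (1 - q) * (1 - - y)" using q by algebra
    show "X = 1 + t * (- z - 1)" using t by algebra
    show "Y = 0 + t * (w - 0)" using XY(2) t w by algebra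
    have "(0 - x) * (w - 0) - (1 - - y) * (- z - 1) = (1 + y) * (1 + z) * (1 - m * n)"
      unfolding x w by (simp add: algebra_simps)
    then show "(0 - x) * (w - 0) - (1 - - y) * (- z - 1) \<noteq> 0" using mn1 b by simp
  qed
  have B4: "inner_pentagon A 4 = V 0 n"
    unfolding inner_pentagon_vertices A
    by (rule inter[where a = "1 / (1 + z)" and b = "1 - n"]) (use b mn \<open>m * n < 1\<close> in \<open>auto simp: n_def field_simps\<close>)
  have outer: "pent_area A = s * d / 2 * (1 + y + z)"
    using convex_cycle_area[OF s cyc] unfolding pent_area_def lessThan_5 image_insert image_empty A or
    by (simp add: field_simps)
  have inner: "pent_area (inner_pentagon A) = s * d / 2 * (m * n * (2 - m - n) / (1 - m * n) - h * k)"
  proof -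
    have "measure lebesgue (convex hull {V 0 k, V h 0, V m 0, V X Y, V 0 n})
        = s * d / 2 * (m * n * (2 - m - n) / (1 - m * n) - h * k)"
      unfolding V_def X_def Y_def d_def using s sd hk hm kn mn
      by (intro inner_star_area) (simp_all add: d_def)
    then show ?thesis
      unfolding pent_area_def lessThan_5 image_insert image_empty B0 B1 B2 B3 B4 .
  qed
  have hk2: "h * k = D\<^sup>2 / ((n * (1 + z) + y) * (m * (1 + y) + z))"
    unfolding x[symmetric] w[symmetric] by (simp add: h_def k_def power2_eq_square add.commute)
  have reg: "affine_regular_pentagon A \<longleftrightarrow> m = golden \<and> n = golden \<and> y = golden \<and> z = golden"
  proof -
    have V: "V u v - V 0 0 = u *\<^sub>R e + v *\<^sub>R f" for u v by (simp add: V_def)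
    have eq: "u *\<^sub>R e + v *\<^sub>R f = u' *\<^sub>R e + v' *\<^sub>R f \<longleftrightarrow> u = u' \<and> v = v'" for u v u' v'
      using frame_coordinates_unique[OF d(2)] by blast
    have "affine_regular_pentagon A \<longleftrightarrow> A 2 - A 1 = 1 *\<^sub>R e + (- golden) *\<^sub>R f \<and> A 0 - A 1 = (- golden) *\<^sub>R e + 1 *\<^sub>R f"
      using affine_regular_pentagon_iff[of A, folded e_def f_def, OF d(2)] by (simp add: algebra_simps)
    also have "\<dots> \<longleftrightarrow> x = 1 \<and> y = golden \<and> z = golden \<and> w = 1"
      unfolding A V eq by auto
    also have "\<dots> \<longleftrightarrow> m = golden \<and> n = golden \<and> y = golden \<and> z = golden"
    proof -
      \<comment> \<open>\<open>golden\<close> and \<open>1 + golden\<close> are reciprocal, so once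
        \<open>y = golden\<close> the condition \<open>x = 1\<close> means
        \<open>m = golden\<close>; likewise for \<open>w\<close> and \<open>n\<close>.\<close>
      have "golden * (1 + golden) = 1" using golden_sq by (simp add: algebra_simps power2_eq_square)
      then have one: "m * (1 + golden) = 1 \<longleftrightarrow> m = golden" for m
        using golden_bounds mult_right_cancel[of "1 + golden" m golden] by simp
      show ?thesis unfolding x w using one[of m] one[of n] by (cases "y = golden \<and> z = golden") auto
    qed
    finally show ?thesis .
  qed
  show thesis
    by (rule that[OF _ mn b(2,3) b(7)[unfolded D] outer inner[unfolded hk2 D] reg]) (use sd in simp)
qed

theorem theorem1p2:
  fixes A :: "nat \<Rightarrow> real^2"
  assumes "convex_pentagon A"
  shows "pent_area (inner_pentagon A) / pent_area A \<le> (7 - 3 * sqrt 5) / 2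
     \<and> (pent_area (inner_pentagon A) / pent_area A = (7 - 3 * sqrt 5) / 2
          \<longleftrightarrow> affine_regular_pentagon A)"
proof -
  obtain c m n y z where c: "0 < c" and mn: "0 < m" "m < 1" "0 < n" "n < 1" and yz: "0 < y" "0 < z"
    and D: "0 < m * n * (1 + y) * (1 + z) - y * z"
    and outer: "pent_area A = c * (1 + y + z)"
    and inner: "pent_area (inner_pentagon A) = c * (m * n * (2 - m - n) / (1 - m * n)
       - (m * n * (1 + y) * (1 + z) - y * z)\<^sup>2 / ((n * (1 + z) + y) * (m * (1 + y) + z)))"
      (is "_ = c * ?I")
    and reg: "affine_regular_pentagon A \<longleftrightarrow> m = golden \<and> n = golden \<and> y = golden \<and> z = golden"
    using pentagon_normal_form[OF assms] .
  have ratio: "pent_area (inner_pentagon A) / pent_area A = ?I / (1 + y + z)"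
    unfolding outer inner using c by simp
  have "0 < 1 + y + z" using yz by simp
  then show ?thesis
    unfolding ratio golden_fourth reg star_area_bound(2)[OF mn yz D, symmetric]
    using star_area_bound(1)[OF mn yz D] by (simp only: pos_divide_le_eq divide_eq_eq) auto
qed

end
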